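(* Let $(X,S)$ be an $S$-metric space and let $\mathcal{I}$ be an admissible ideal of $\mathbb{N}$. If a sequence $\{x_n\}_{n\in\mathbb{N}}$ in $X$ is $\mathcal{I}$-localized in itself and contains an $\mathcal{I}$-nonthin Cauchy subsequence, then $\{x_n\}_{n\in\mathbb{N}}$ is an $\mathcal{I}$-Cauchy sequence.
   Context: An $S$-metric on a nonempty set $X$ is a function $S:X\times X\times X\to[0,\infty)$ such that for all $x,y,z,a\in X$: (i) $S(x,y,z)\ge 0$; (ii) $S(x,y,z)=0$ if and only if $x=y=z$; (iii) $S(x,y,z)\le S(x,x,a)+S(y,y,a)+S(z,z,a)$. The pair $(X,S)$ is called an $S$-metric space. An ideal $\mathcal{I}$ of $\mathbb{N}$ is a collection of subsets of $\mathbb{N}$ closed under finite unions and under taking subsets; it is non-trivial if it is neither $\{\emptyset\}$ nor $2^{\mathbb{N}}$, and admissible if it is non-trivial and $\{n\}\in\mathcal{I}$ for every $n\in\mathbb{N}$. The associated filter is $\mathcal{F}(\mathcal{I})=\{A\subset\mathbb{N}:\mathbb{N}\setminus A\in\mathcal{I}\}$. A real sequence $\{a_n\}_{n\in\mathbb{N}}$ is $\mathcal{I}$-convergent to $a\in\mathbb{R}$ if $\{n\in\mathbb{N}:|a_n-a|\ge\varepsilon\}\in\mathcal{I}$ for every $\varepsilon>0$. A sequence $\{x_n\}$ in $X$ is $\mathcal{I}$-localized in $M\subset X$ if for each $x\in M$ the real sequence $\{S(x_n,x_n,x)\}_{n\in\mathbb{N}}$ is $\mathcal{I}$-convergent. The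 $\mathcal{I}$-locator $loc_{\mathcal{I}}(x_n)$ is the maximal subset of $X$ on which $\{x_n\}$ is $\mathcal{I}$-localized. The sequence $\{x_n\}$ is $\mathcal{I}$-localized in itself if $\{n\in\mathbb{N}:x_n\in loc_{\mathcal{I}}(x_n)\}\in\mathcal{F}(\mathcal{I})$. For $M=\{m_1<m_2<\cdots\}\subset\mathbb{N}$, the subsequence $\{x_n\}_{n\in M}$ of $\{x_n\}_{n\in\mathbb{N}}$ is called $\mathcal{I}$-nonthin if $M\notin\mathcal{I}$. A sequence $\{y_n\}$ in $X$ is Cauchy if for each $\varepsilon>0$ there is $n_0\in\mathbb{N}$ with $S(y_n,y_n,y_m)<\varepsilon$ for all $n,m\ge n_0$. A sequence $\{x_n\}$ in $X$ is $\mathcal{I}$-Cauchy if for every $\varepsilon>0$ there is a positive integer $n_0=n_0(\varepsilon)$ such that $\{n\in\mathbb{N}:S(x_n,x_n,x_{n_0})\ge\varepsilon\}\in\mathcal{I}$. *)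

theory Defs
  imports Complex_Main "HOL-Library.Infinite_Set"
begin

locale S_metric_space =
  fixes X :: "'a set" and S :: "'a \<Rightarrow> 'a \<Rightarrow> 'a \<Rightarrow> real"
  assumes nonempty: "X \<noteq> {}"
    and nonneg: "\<lbrakk>x \<in> X; y \<in> X; z \<in> X\<rbrakk> \<Longrightarrow> 0 \<le> S x y z"
    and zero_iff: "\<lbrakk>x \<in> X; y \<in> X; z \<in> X\<rbrakk> \<Longrightarrow> S x y z = 0 \<longleftrightarrow> x = y \<and> y = z"
    and triangle: "\<lbrakk>x \<in> X; y \<in> X; z \<in> X; a \<in> X\<rbrakk> \<Longrightarrow> S x y z \<le> S x x a + S y y a + S z z a"

definition set_ideal :: "nat set set \<Rightarrow> bool" where
  "set_ideal I \<longleftrightarrow>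
     {} \<in> I \<and> (\<forall>A\<in>I. \<forall>B\<in>I. A \<union> B \<in> I) \<and> (\<forall>A\<in>I. \<forall>B. B \<subseteq> A \<longrightarrow> B \<in> I)"

definition nontrivial_ideal :: "nat set set \<Rightarrow> bool" where
  "nontrivial_ideal I \<longleftrightarrow> set_ideal I \<and> I \<noteq> {{}} \<and> I \<noteq> Pow UNIV"

definition admissible_ideal :: "nat set set \<Rightarrow> bool" where
  "admissible_ideal I \<longleftrightarrow> nontrivial_ideal I \<and> (\<forall>n. {n} \<in> I)"

definition ideal_filter :: "nat set set \<Rightarrow> nat set set" where
  "ideal_filter I = {A. UNIV - A \<in> I}"

definition ideal_convergent_to :: "nat set set \<Rightarrow> (nat \<Rightarrow> real) \<Rightarrow> real \<Rightarrow> bool" where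
  "ideal_convergent_to I a l \<longleftrightarrow> (\<forall>\<epsilon>>0. {n. \<bar>a n - l\<bar> \<ge> \<epsilon>} \<in> I)"

definition ideal_convergent :: "nat set set \<Rightarrow> (nat \<Rightarrow> real) \<Rightarrow> bool" where
  "ideal_convergent I a \<longleftrightarrow> (\<exists>l. ideal_convergent_to I a l)"

definition ideal_localized_on ::
    "'a set \<Rightarrow> ('a \<Rightarrow> 'a \<Rightarrow> 'a \<Rightarrow> real) \<Rightarrow> nat set set \<Rightarrow> (nat \<Rightarrow> 'a) \<Rightarrow> 'a set \<Rightarrow> bool" where
  "ideal_localized_on X S I x M \<longleftrightarrow>
     M \<subseteq> X \<and> (\<forall>z\<in>M. ideal_convergent I (\<lambda>n. S (x n) (x n) z))"

text \<open>Maximality is with respect to inclusion; \<open>ideal_locator_eq\<close> below shows that a greatest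
  such set always exists, so the description is proper.\<close>

definition ideal_locator ::
    "'a set \<Rightarrow> ('a \<Rightarrow> 'a \<Rightarrow> 'a \<Rightarrow> real) \<Rightarrow> nat set set \<Rightarrow> (nat \<Rightarrow> 'a) \<Rightarrow> 'a set" where
  "ideal_locator X S I x = (GREATEST M. ideal_localized_on X S I x M)"

lemma ideal_locator_eq:
  "ideal_locator X S I x = {z \<in> X. ideal_convergent I (\<lambda>n. S (x n) (x n) z)}"
  unfolding ideal_locator_def
  by (rule Greatest_equality) (auto simp: ideal_localized_on_def)

definition ideal_localized_in_itself ::
    "'a set \<Rightarrow> ('a \<Rightarrow> 'a \<Rightarrow> 'a \<Rightarrow> real) \<Rightarrow> nat set set \<Rightarrow> (nat \<Rightarrow> 'a) \<Rightarrow> bool" where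
  "ideal_localized_in_itself X S I x \<longleftrightarrow> {n. x n \<in> ideal_locator X S I x} \<in> ideal_filter I"

definition S_Cauchy :: "('a \<Rightarrow> 'a \<Rightarrow> 'a \<Rightarrow> real) \<Rightarrow> (nat \<Rightarrow> 'a) \<Rightarrow> bool" where
  "S_Cauchy S y \<longleftrightarrow> (\<forall>\<epsilon>>0. \<exists>n0. \<forall>n\<ge>n0. \<forall>m\<ge>n0. S (y n) (y n) (y m) < \<epsilon>)"

text \<open>For infinite \<open>M = {m\<^sub>1 < m\<^sub>2 < \<dots>}\<close>, \<open>enumerate M\<close> lists \<open>M\<close> increasingly,
  so \<open>x \<circ> enumerate M\<close> is the subsequence of \<open>x\<close> indexed by \<open>M\<close>.\<close>

definition has_nonthin_Cauchy_subseq ::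
    "('a \<Rightarrow> 'a \<Rightarrow> 'a \<Rightarrow> real) \<Rightarrow> nat set set \<Rightarrow> (nat \<Rightarrow> 'a) \<Rightarrow> bool" where
  "has_nonthin_Cauchy_subseq S I x \<longleftrightarrow>
     (\<exists>M. infinite M \<and> M \<notin> I \<and> S_Cauchy S (x \<circ> enumerate M))"

definition ideal_Cauchy ::
    "('a \<Rightarrow> 'a \<Rightarrow> 'a \<Rightarrow> real) \<Rightarrow> nat set set \<Rightarrow> (nat \<Rightarrow> 'a) \<Rightarrow> bool" where
  "ideal_Cauchy S I x \<longleftrightarrow> (\<forall>\<epsilon>>0. \<exists>n0>0. {n. S (x n) (x n) (x n0) \<ge> \<epsilon>} \<in> I)"

end

theory Submission
  imports Defs
begin

text \<open>Fix \<open>\<epsilon>\<close> and choose an index \<open>n0\<close> in the tail of the nonthin Cauchy subsequence with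
  \<open>x n0\<close> in the locator. The ideal limit of \<open>S (x n) (x n) (x n0)\<close> exists, and it is small
  because the values are small along the tail, which is not in the ideal.\<close>

lemma set_ideal_subset: "set_ideal I \<Longrightarrow> A \<in> I \<Longrightarrow> B \<subseteq> A \<Longrightarrow> B \<in> I"
  unfolding set_ideal_def by blast

lemma set_ideal_Un: "set_ideal I \<Longrightarrow> A \<in> I \<Longrightarrow> B \<in> I \<Longrightarrow> A \<union> B \<in> I"
  unfolding set_ideal_def by blast

text \<open>If the difference were in \<open>I\<close>, then \<open>M\<close> would lie in the union
  of two members of \<open>I\<close>. This keeps a nonthin index set nonthin after an initial
  segment is cut off.\<close>

lemma nonthin_Diff:
  assumes "set_ideal I" "M \<notin> I" "A \<in> I"
  shows "M - A \<notin> I"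
proof
  assume "M - A \<in> I"
  then have "(M - A) \<union> A \<in> I" by (rule set_ideal_Un[OF assms(1) _ assms(3)])
  then have "M \<in> I" by (rule set_ideal_subset[OF assms(1)]) auto
  with assms(2) show False ..
qed

text \<open>Source of witnesses: a property that fails only on a set in \<open>I\<close> holds at
  some index of any nonthin set.\<close>

lemma nonthin_not_subset:
  assumes "set_ideal I" "M \<notin> I" "A \<in> I"
  obtains n where "n \<in> M" "n \<notin> A"
proof -
  have "\<not> M \<subseteq> A" using set_ideal_subset[OF assms(1,3)] assms(2) by metis
  then show thesis using that by auto
qed

lemma admissible_ideal_set_ideal: "admissible_ideal I \<Longrightarrow> set_ideal I"
  by (simp add: admissible_ideal_def nontrivial_ideal_def)

lemma admissible_ideal_finite:
  assumes "admissible_ideal I" "finite A"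
  shows "A \<in> I"
  using assms(2)
proof (induction A rule: finite_induct)
  case empty
  show ?case using admissible_ideal_set_ideal[OF assms(1)] by (simp add: set_ideal_def)
next
  case (insert a A)
  have "{a} \<in> I" using assms(1) by (simp add: admissible_ideal_def)
  then show ?case
    using set_ideal_Un[OF admissible_ideal_set_ideal[OF assms(1)], of "{a}" A] insert.IH by simp
qed

text \<open>Turns the Cauchy condition, stated for positions in the enumeration, into one on the
  indices themselves. If it holds from position \<open>N\<close> on, then
  \<open>k = enumerate M N\<close> works: the enumeration is strictly increasing, so elements of
  \<open>M\<close> from \<open>k\<close> on sit at positions at least \<open>N\<close>.\<close>

lemma S_Cauchy_subseq_tail:
  fixes M :: "nat set"
  assumes "infinite M" "S_Cauchy S (x \<circ> enumerate M)" "\<epsilon> > 0"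
  shows "\<exists>k. \<forall>n\<in>M. \<forall>m\<in>M. k \<le> n \<longrightarrow> k \<le> m \<longrightarrow> S (x n) (x n) (x m) < \<epsilon>"
proof -
  obtain N where N: "S (x (enumerate M i)) (x (enumerate M i)) (x (enumerate M j)) < \<epsilon>"
    if "N \<le> i" "N \<le> j" for i j
    using assms(2,3) unfolding S_Cauchy_def comp_def by blast
  have index: "\<exists>i\<ge>N. enumerate M i = n" if n: "n \<in> M" "enumerate M N \<le> n" for n
  proof -
    obtain i where i: "enumerate M i = n" using enumerate_Ex[OF assms(1) n(1)] by blast
    have "N \<le> i"
    proof (rule ccontr)
      assume "\<not> N \<le> i"
      then have "enumerate M i < enumerate M N" by (simp add: enumerate_mono assms(1))
      with n(2) i show False by simp
    qed
    with i show ?thesis by blast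
  qed
  show ?thesis
  proof (intro exI[of _ "enumerate M N"] ballI impI)
    fix n m assume "n \<in> M" "m \<in> M" "enumerate M N \<le> n" "enumerate M N \<le> m"
    then obtain i j where "N \<le> i" "enumerate M i = n" "N \<le> j" "enumerate M j = m"
      using index by meson
    then show "S (x n) (x n) (x m) < \<epsilon>" using N[of i j] by simp
  qed
qed

theorem theorem3p6:
  fixes X :: "'a set"
    and S :: "'a \<Rightarrow> 'a \<Rightarrow> 'a \<Rightarrow> real"
    and I :: "nat set set"
    and x :: "nat \<Rightarrow> 'a"
  assumes "S_metric_space X S"
    and "admissible_ideal I"
    and "range x \<subseteq> X"
    and "ideal_localized_in_itself X S I x"
    and "has_nonthin_Cauchy_subseq S I x"
  shows "ideal_Cauchy S I x"
  unfolding ideal_Cauchy_def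
proof (intro allI impI)
  fix \<epsilon> :: real assume "\<epsilon> > 0"
  note ideal = admissible_ideal_set_ideal[OF assms(2)]
  obtain M where M: "infinite M" "M \<notin> I" "S_Cauchy S (x \<circ> enumerate M)"
    using assms(5) unfolding has_nonthin_Cauchy_subseq_def by blast
  obtain k where k: "\<And>n m. \<lbrakk>n \<in> M; m \<in> M; k \<le> n; k \<le> m\<rbrakk> \<Longrightarrow> S (x n) (x n) (x m) < \<epsilon> / 4"
    using S_Cauchy_subseq_tail[OF M(1,3), of "\<epsilon> / 4"] \<open>\<epsilon> > 0\<close>
    by (meson divide_pos_pos zero_less_numeral)
  \<comment> \<open>Removing \<open>k\<close> itself as well forces the later \<open>n0\<close> to
    exceed \<open>k\<close>, hence to be positive, as \<open>ideal_Cauchy\<close> demands.\<close>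
  have tail: "M - {..k} \<notin> I"
    by (rule nonthin_Diff[OF ideal M(2)]) (simp add: admissible_ideal_finite[OF assms(2)])
  have "UNIV - {n. x n \<in> ideal_locator X S I x} \<in> I"
    using assms(4) by (simp add: ideal_localized_in_itself_def ideal_filter_def)
  then obtain n0 where "n0 \<in> M - {..k}" "n0 \<notin> UNIV - {n. x n \<in> ideal_locator X S I x}"
    by (rule nonthin_not_subset[OF ideal tail])
  then have n0: "n0 \<in> M" "k < n0" "x n0 \<in> ideal_locator X S I x"
    by simp_all
  then obtain l where "ideal_convergent_to I (\<lambda>n. S (x n) (x n) (x n0)) l"
    by (auto simp: ideal_locator_eq ideal_convergent_def)
  then have far: "{n. \<bar>S (x n) (x n) (x n0) - l\<bar> \<ge> \<epsilon> / 4} \<in> I"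
    using \<open>\<epsilon> > 0\<close> unfolding ideal_convergent_to_def by (meson divide_pos_pos zero_less_numeral)
  \<comment> \<open>At this single index the value is both within \<open>\<epsilon> / 4\<close> of
    \<open>l\<close> and, by the choice of \<open>k\<close>, below \<open>\<epsilon> / 4\<close>,
    which bounds \<open>l\<close> by \<open>\<epsilon> / 2\<close>.\<close>
  then obtain n where "n \<in> M - {..k}" "n \<notin> {n. \<bar>S (x n) (x n) (x n0) - l\<bar> \<ge> \<epsilon> / 4}"
    by (rule nonthin_not_subset[OF ideal tail])
  then have "n \<in> M" "k < n" "\<bar>S (x n) (x n) (x n0) - l\<bar> < \<epsilon> / 4"
    by simp_all
  moreover from this n0 have "S (x n) (x n) (x n0) < \<epsilon> / 4"
    by (intro k) simp_all
  ultimately have "l < \<epsilon> / 2"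
    by linarith
  \<comment> \<open>A value of at least \<open>\<epsilon>\<close> exceeds \<open>l\<close> by more
    than \<open>\<epsilon> / 2\<close>, so its index is among those in \<open>far\<close>.\<close>
  then have "{n. S (x n) (x n) (x n0) \<ge> \<epsilon>} \<subseteq> {n. \<bar>S (x n) (x n) (x n0) - l\<bar> \<ge> \<epsilon> / 4}"
    using \<open>\<epsilon> > 0\<close> by auto
  then have "{n. S (x n) (x n) (x n0) \<ge> \<epsilon>} \<in> I"
    by (rule set_ideal_subset[OF ideal far])
  moreover have "n0 > 0"
    using n0(2) by simp
  ultimately show "\<exists>n0>0. {n. S (x n) (x n) (x n0) \<ge> \<epsilon>} \<in> I"
    by blast
qed

end
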